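(* Let $s\geq 1$ be an integer and let $0\leq c_1<\dots<c_s\leq 1$ be real numbers. Then: (i) there exist $D\in\mathcal{M}_s(\mathbb{R})$ and $\theta_1,\dots,\theta_s\in\mathbb{R}$ such that the step defined by $(D,\theta_1,\dots,\theta_s)$ (for the nodes $c_1,\dots,c_s$) is stable and has order $s$; (ii) there exist $D\in\mathcal{M}_s(\mathbb{R})$ and $\theta_1,\dots,\theta_s\in\mathbb{R}$ such that the step defined by $(D,\theta_1,\dots,\theta_s)$ (for the nodes $c_1,\dots,c_s$) is strongly stable and has order $s$.
   Context: $\mathcal{M}_s(\mathbb{R})$ is the set of real $s\times s$ matrices. Given nodes $c_1,\dots,c_s$, a matrix $D$ and numbers $\theta_1,\dots,\theta_s$, the associated step is the update $(\gamma_{n+c_1},\dots,\gamma_{n+c_s})^T=D(\gamma_{n-1+c_1},\dots,\gamma_{n-1+c_s})^T+(\theta_1,\dots,\theta_s)^T N(u_n)$, where $N$ is the nonlinearity of an evolution equation and $u_n$ is the current approximation of its solution. Stability: the step is stable if $\sup_{n\in\mathbb{N}}\|D^n\|<+\infty$ for some (equivalently any) norm on $\mathcal{M}_s(\mathbb{R})$. It is strongly stable if $\rho(D)<1$, where $\rho(D)$ is the spectral radius of $D$, i.e. the largest modulus of its complex eigenvalues. Consistency of order $s$: for $h>0$ define the $s\times s$ matrices $V_c^h$, $V_{c-1}^h$ and $\Theta$ by $(V_c^h)_{ij}=(c_ih)^{j-1}$ and $(V_{c-1}^h)_{ij}=((c_i-1)h)^{j-1}$ for $1\leq i,j\leq s$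 (with the convention $0^0=1$), and $(\Theta)_{i1}=\theta_i$, $(\Theta)_{ij}=0$ for $j\geq 2$. The step is said to be consistent of order $s$ (or of order $s$) if for all $h>0$, $V_c^h=D\,V_{c-1}^h+\Theta$. *)

theory Defs
  imports "Jordan_Normal_Form.Spectral_Radius"
begin

text \<open>
  A step is the update
  \<open>\<gamma>(n + c\<^sub>i) = (\<Sum>j. D\<^sub>i\<^sub>j \<gamma>(n - 1 + c\<^sub>j)) + \<theta>\<^sub>i N(u\<^sub>n)\<close>.
  It is given by its nodes \<open>c\<close> and weights \<open>\<theta>\<close> (vectors of dimension \<open>s\<close>) and its
  \<open>s \<times> s\<close> matrix \<open>D\<close>. Rows and columns are numbered from \<open>0\<close>, so
  the exponent \<open>j - 1\<close> of the usual one-based numbering becomes \<open>j\<close>.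
\<close>

definition is_matrix_norm :: "nat \<Rightarrow> (real mat \<Rightarrow> real) \<Rightarrow> bool" where
  "is_matrix_norm s N \<longleftrightarrow>
     (\<forall>A \<in> carrier_mat s s. 0 \<le> N A \<and> (N A = 0 \<longleftrightarrow> A = 0\<^sub>m s s)) \<and>
     (\<forall>a. \<forall>A \<in> carrier_mat s s. N (a \<cdot>\<^sub>m A) = \<bar>a\<bar> * N A) \<and>
     (\<forall>A \<in> carrier_mat s s. \<forall>B \<in> carrier_mat s s. N (A + B) \<le> N A + N B)"

text \<open>
  Only the vector space axioms of a norm are required (no submultiplicativity); all such norms
  are equivalent, so the choice of norm below is immaterial.
\<close>

definition stable_step :: "nat \<Rightarrow> real mat \<Rightarrow> bool" where
  "stable_step s D \<longleftrightarrow>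
     (\<exists>N. is_matrix_norm s N \<and> bdd_above (range (\<lambda>n::nat. N (D ^\<^sub>m n))))"

definition strongly_stable_step :: "real mat \<Rightarrow> bool" where
  "strongly_stable_step D \<longleftrightarrow> spectral_radius (map_mat complex_of_real D) < 1"

definition V_c :: "nat \<Rightarrow> real vec \<Rightarrow> real \<Rightarrow> real mat" where
  "V_c s c h = mat s s (\<lambda>(i, j). (c $ i * h) ^ j)"

definition V_c_minus_1 :: "nat \<Rightarrow> real vec \<Rightarrow> real \<Rightarrow> real mat" where
  "V_c_minus_1 s c h = mat s s (\<lambda>(i, j). ((c $ i - 1) * h) ^ j)"

definition Theta_mat :: "nat \<Rightarrow> real vec \<Rightarrow> real mat" where
  "Theta_mat s \<theta> = mat s s (\<lambda>(i, j). if j = 0 then \<theta> $ i else 0)"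

text \<open>Consistency of order \<open>s\<close>, where \<open>s\<close> is also the number of nodes.\<close>

definition step_of_order :: "nat \<Rightarrow> real vec \<Rightarrow> real mat \<Rightarrow> real vec \<Rightarrow> bool" where
  "step_of_order s c D \<theta> \<longleftrightarrow>
     (\<forall>h>0. V_c s c h = D * V_c_minus_1 s c h + Theta_mat s \<theta>)"

end

theory Submission
  imports Defs
begin

text \<open>
  Read a vector of \<open>\<real>\<^sup>s\<close> as the values of a polynomial \<open>p\<close> of degree less than \<open>s\<close> at the
  points \<open>c\<^sub>i - 1\<close>. Order \<open>s\<close> with weights \<open>\<theta>\<^sub>i = w(c\<^sub>i - 1)\<close>, where \<open>w\<close> has degree less than
  \<open>s\<close>, then says that \<open>D\<close> acts as the operator \<open>(T p)(x) = p(x + 1) - p(0) w(x)\<close>; the monomials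
  \<open>(h x)\<^sup>k\<close> give the columns of the matrix identity. Since the polynomial \<open>w\<close> is at our disposal,
  the task is to choose it so that the powers of \<open>T\<close> are small.

  The best choice makes \<open>T\<close> nilpotent. Look at \<open>p\<close> through its values at
  \<open>-1, \<dots>, -s\<close> instead. If \<open>w(-1) = 1\<close> and \<open>w\<close> vanishes at \<open>-2, \<dots>, -s\<close>, then
  \<open>(T p)(-1) = p(0) - p(0) = 0\<close> and \<open>(T p)(-k) = p(-(k - 1))\<close> for \<open>2 \<le> k \<le> s\<close>: in these
  coordinates \<open>T\<close> is a shift that feeds in zeros. So \<open>T\<^sup>s p\<close> has \<open>s\<close> zeros and degree less
  than \<open>s\<close>, hence is zero (\<open>funpow_transported_eq_0\<close>), and \<open>D\<^sup>s = 0\<close>. A nilpotent matrix has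
  finitely many distinct powers and \<open>0\<close> as its only eigenvalue, so the same \<open>D\<close> and \<open>\<theta>\<close> serve
  for both claims.
\<close>

section \<open>Lagrange interpolation\<close>

definition lagrange_basis :: "nat \<Rightarrow> (nat \<Rightarrow> 'a::field) \<Rightarrow> nat \<Rightarrow> 'a poly" where
  "lagrange_basis s x j = (\<Prod>k\<in>{..<s} - {j}. Polynomial.smult (1 / (x j - x k)) [:- x k, 1:])"

lemma degree_lagrange_basis:
  assumes "j < s"
  shows "degree (lagrange_basis s x j) < s"
proof -
  have "degree (lagrange_basis s x j)
      \<le> (\<Sum>k\<in>{..<s} - {j}. degree (Polynomial.smult (1 / (x j - x k)) [:- x k, 1:]))"
    unfolding lagrange_basis_def
    by (rule order_trans[OF degree_prod_sum_le]) (simp_all add: o_def)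
  also have "\<dots> \<le> (\<Sum>k\<in>{..<s} - {j}. 1)"
    by (rule sum_mono) simp
  also have "\<dots> < s"
    using assms by simp
  finally show ?thesis .
qed

lemma poly_lagrange_basis:
  assumes "inj_on x {..<s}" "i < s" "j < s"
  shows "poly (lagrange_basis s x j) (x i) = (if i = j then 1 else 0)"
proof (cases "i = j")
  case True
  have "x j \<noteq> x k" if "k \<in> {..<s} - {j}" for k
    using that assms by (auto dest: inj_onD)
  then show ?thesis
    using True
    by (auto simp: lagrange_basis_def poly_prod simp flip: diff_divide_distrib
        intro!: prod.neutral)
next
  case False
  then show ?thesis
    using assms by (auto simp: lagrange_basis_def poly_prod)
qed

lemma lagrange_interpolation:
  assumes "inj_on x {..<s}" "degree p < s"
  shows "(\<Sum>j<s. poly (lagrange_basis s x j) y * poly p (x j)) = poly p y"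
proof -
  let ?q = "\<Sum>j<s. Polynomial.smult (poly p (x j)) (lagrange_basis s x j)"
  have "degree ?q < s"
    using assms(2) by (intro degree_sum_less)
      (auto intro!: le_less_trans[OF degree_smult_le] degree_lagrange_basis)
  moreover have "poly ?q (x i) = poly p (x i)" if "i < s" for i
    using that by (simp add: poly_sum poly_lagrange_basis[OF assms(1)] if_distrib cong: if_cong)
  ultimately have "?q = p"
    using assms by (intro poly_eqI_degree[of "x ` {..<s}"]) (auto simp: card_image)
  then have "poly p y = poly ?q y"
    by simp
  then show ?thesis
    by (simp add: poly_sum mult.commute)
qed

section \<open>The nilpotent transport operator\<close>

definition transported :: "'a::field poly \<Rightarrow> 'a poly \<Rightarrow> 'a poly" where
  "transported w p = pcompose p [:1, 1:] - Polynomial.smult (poly p 0) w"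

lemma poly_transported:
  "poly (transported w p) y = poly p (y + 1) - poly p 0 * poly w y"
  by (simp add: transported_def poly_pcompose add.commute)

lemma degree_transported:
  assumes "degree p < s" "degree w < s"
  shows "degree (transported w p) < s"
  unfolding transported_def using assms
  by (intro degree_diff_less) (auto simp: degree_pcompose intro: le_less_trans[OF degree_smult_le])

lemma degree_funpow_transported:
  assumes "degree p < s" "degree w < s"
  shows "degree ((transported w ^^ n) p) < s"
  using assms by (induction n) (auto intro: degree_transported)

text \<open>
  The normalisation \<open>w(-1) = 1\<close> creates a zero of \<open>T p\<close> at \<open>-1\<close>, and the zeros of \<open>w\<close> at
  \<open>-2, \<dots>, -s\<close> let every zero of \<open>p\<close> among \<open>-1, \<dots>, -(s - 1)\<close> move one place to the left; so
  \<open>n\<close> applications force zeros at \<open>-1, \<dots>, -n\<close>.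
\<close>

lemma poly_funpow_transported_eq_0:
  fixes w p :: "'a::field poly"
  assumes w: "\<And>k. k < s \<Longrightarrow> poly w (- of_nat (Suc k)) = (if k = 0 then 1 else 0)"
    and "k < n" "n \<le> s"
  shows "poly ((transported w ^^ n) p) (- of_nat (Suc k)) = 0"
  using assms(2,3)
proof (induction n arbitrary: k)
  case (Suc n)
  show ?case
  proof (cases k)
    case 0
    then show ?thesis
      using w[of 0] Suc.prems by (simp add: poly_transported)
  next
    case (Suc l)
    have "poly ((transported w ^^ n) p) (- of_nat (Suc l)) = 0"
      using Suc.IH[of l] Suc.prems Suc by simp
    moreover have "- of_nat (Suc k) + 1 = (- of_nat (Suc l) :: 'a)"
      using Suc by simp
    ultimately show ?thesis
      using w[of k] Suc.prems Suc by (simp add: poly_transported del: of_nat_Suc)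
  qed
qed simp

lemma funpow_transported_eq_0:
  fixes w p :: "'a::field_char_0 poly"
  assumes "\<And>k. k < s \<Longrightarrow> poly w (- of_nat (Suc k)) = (if k = 0 then 1 else 0)"
    and "degree w < s" "degree p < s"
  shows "(transported w ^^ s) p = 0"
proof (rule poly_eqI_degree)
  let ?A = "(\<lambda>k. - of_nat (Suc k) :: 'a) ` {..<s}"
  have "card ?A = s"
    by (subst card_image) (auto simp: inj_on_def)
  then show "degree ((transported w ^^ s) p) < card ?A" "degree (0 :: 'a poly) < card ?A"
    using degree_funpow_transported[OF assms(3,2)] assms(2) by auto
  show "poly ((transported w ^^ s) p) y = poly 0 y" if "y \<in> ?A" for y
    using that poly_funpow_transported_eq_0[OF assms(1)] by auto
qed

section \<open>The operator in nodal coordinates\<close>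

definition node_values :: "nat \<Rightarrow> (nat \<Rightarrow> 'a::field) \<Rightarrow> 'a poly \<Rightarrow> 'a vec" where
  "node_values s x p = vec s (\<lambda>i. poly p (x i))"

text \<open>
  For distinct nodes, \<open>lagrange_basis s x j\<close> has the \<open>j\<close>-th unit vector as its node values, so this is
  the matrix of \<open>transported w\<close> with respect to the coordinates \<open>node_values s x\<close>.
\<close>

definition transport_mat :: "nat \<Rightarrow> (nat \<Rightarrow> 'a::field) \<Rightarrow> 'a poly \<Rightarrow> 'a mat" where
  "transport_mat s x w = mat s s (\<lambda>(i, j). poly (transported w (lagrange_basis s x j)) (x i))"

lemma transport_mat_carrier [simp]: "transport_mat s x w \<in> carrier_mat s s"
  by (simp add: transport_mat_def)

lemma transport_mat_node_values:
  assumes "inj_on x {..<s}" "degree p < s"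
  shows "transport_mat s x w *\<^sub>v node_values s x p = node_values s x (transported w p)"
proof (rule eq_vecI)
  fix i assume "i < dim_vec (node_values s x (transported w p))"
  then have i: "i < s"
    by (simp add: node_values_def)
  let ?l = "lagrange_basis s x"
  have "(transport_mat s x w *\<^sub>v node_values s x p) $ i
      = (\<Sum>j<s. (poly (?l j) (x i + 1) - poly (?l j) 0 * poly w (x i)) * poly p (x j))"
    using i by (simp add: transport_mat_def node_values_def scalar_prod_def poly_transported
        lessThan_atLeast0)
  also have "\<dots> = (\<Sum>j<s. poly (?l j) (x i + 1) * poly p (x j))
      - (\<Sum>j<s. poly (?l j) 0 * poly p (x j)) * poly w (x i)"
    by (simp add: algebra_simps sum_subtractf sum_distrib_left)
  also have "\<dots> = poly (transported w p) (x i)"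
    by (simp add: lagrange_interpolation[OF assms] poly_transported)
  finally show "(transport_mat s x w *\<^sub>v node_values s x p) $ i
      = node_values s x (transported w p) $ i"
    using i by (simp add: node_values_def)
qed (simp add: transport_mat_def node_values_def)

lemma transport_mat_pow_node_values:
  assumes "inj_on x {..<s}" "degree p < s" "degree w < s"
  shows "(transport_mat s x w ^\<^sub>m n) *\<^sub>v node_values s x p
    = node_values s x ((transported w ^^ n) p)"
  using assms(2)
proof (induction n arbitrary: p)
  case 0
  then show ?case
    by (simp add: node_values_def transport_mat_def)
next
  case (Suc n)
  let ?D = "transport_mat s x w"
  have "(?D ^\<^sub>m Suc n) *\<^sub>v node_values s x p = (?D ^\<^sub>m n) *\<^sub>v (?D *\<^sub>v node_values s x p)"
    by (simp add: node_values_def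
        assoc_mult_mat_vec[OF pow_carrier_mat[OF transport_mat_carrier] transport_mat_carrier])
  also have "\<dots> = node_values s x ((transported w ^^ n) (transported w p))"
    using Suc assms by (simp add: transport_mat_node_values degree_transported)
  finally show ?case
    by (simp add: funpow_swap1)
qed

lemma transport_mat_nilpotent:
  fixes x :: "nat \<Rightarrow> 'a::field_char_0"
  assumes "inj_on x {..<s}" "degree w < s"
    and "\<And>k. k < s \<Longrightarrow> poly w (- of_nat (Suc k)) = (if k = 0 then 1 else 0)"
  shows "transport_mat s x w ^\<^sub>m s = 0\<^sub>m s s"
proof (rule eq_matI)
  let ?M = "transport_mat s x w ^\<^sub>m s"
  have M: "?M \<in> carrier_mat s s"
    by simp
  fix i j assume "i < dim_row (0\<^sub>m s s :: 'a mat)" "j < dim_col (0\<^sub>m s s :: 'a mat)"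
  then have ij: "i < s" "j < s"
    by auto
  have "unit_vec s j = node_values s x (lagrange_basis s x j)"
    using ij by (auto simp: node_values_def unit_vec_def poly_lagrange_basis[OF assms(1)])
  then have "?M *\<^sub>v unit_vec s j = node_values s x 0"
    using assms ij
    by (simp add: transport_mat_pow_node_values degree_lagrange_basis funpow_transported_eq_0)
  moreover have "A $$ (i, j) = (A *\<^sub>v unit_vec s j) $ i"
    if "A \<in> carrier_mat s s" for A :: "'a mat"
    using ij that by simp
  note this[OF M]
  ultimately show "?M $$ (i, j) = 0\<^sub>m s s $$ (i, j)"
    using ij by (simp add: node_values_def)
qed (auto simp: transport_mat_def)

text \<open>
  Column \<open>k\<close> of the identity of order \<open>s\<close> is the action of \<open>D\<close> on \<open>(h x)\<^sup>k\<close>. The correction term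
  \<open>p(0) w\<close> survives for \<open>k = 0\<close> only, which is exactly where the matrix of the weights has its
  nonzero column.
\<close>

lemma step_of_order_transport_mat:
  assumes "inj_on (\<lambda>i. c $ i - 1) {..<s}"
  shows "step_of_order s c (transport_mat s (\<lambda>i. c $ i - 1) w)
    (node_values s (\<lambda>i. c $ i - 1) w)"
  unfolding step_of_order_def
proof (intro allI impI)
  fix h :: real assume "h > 0"
  let ?x = "\<lambda>i. c $ i - 1"
  let ?D = "transport_mat s ?x w"
  let ?W = "V_c_minus_1 s c h"
  let ?T = "Theta_mat s (node_values s ?x w)"
  have W: "?W \<in> carrier_mat s s"
    by (simp add: V_c_minus_1_def)
  show "V_c s c h = ?D * ?W + ?T"
  proof (rule eq_matI)
    fix i k assume "i < dim_row (?D * ?W + ?T)" "k < dim_col (?D * ?W + ?T)"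
    then have ik: "i < s" "k < s"
      by (auto simp: Theta_mat_def)
    let ?p = "Polynomial.monom (h ^ k) k"
    have deg: "degree ?p < s"
      using ik by (meson Polynomial.degree_monom_le le_less_trans)
    have col: "col ?W k = node_values s ?x ?p"
      using ik by (auto simp: V_c_minus_1_def node_values_def poly_monom power_mult_distrib)
    have "(?D * ?W) $$ (i, k) = (?D *\<^sub>v col ?W k) $ i"
      using ik W by (simp add: transport_mat_def)
    also have "\<dots> = poly (transported w ?p) (?x i)"
      unfolding col transport_mat_node_values[OF assms deg]
      using ik by (simp add: node_values_def)
    finally have "(?D * ?W) $$ (i, k) = (c $ i * h) ^ k - (if k = 0 then poly w (?x i) else 0)"
      by (simp add: poly_transported poly_monom power_mult_distrib)
    then show "V_c s c h $$ (i, k) = (?D * ?W + ?T) $$ (i, k)"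
      using ik W by (simp add: V_c_def Theta_mat_def node_values_def)
  qed (auto simp: V_c_def Theta_mat_def)
qed

section \<open>Nilpotent matrices and stability\<close>

lemma is_matrix_norm_sum_abs:
  "is_matrix_norm s (\<lambda>A. \<Sum>i<s. \<Sum>j<s. \<bar>A $$ (i, j)\<bar>)"
  unfolding is_matrix_norm_def
proof (intro conjI ballI allI)
  fix A :: "real mat" assume A: "A \<in> carrier_mat s s"
  show "0 \<le> (\<Sum>i<s. \<Sum>j<s. \<bar>A $$ (i, j)\<bar>)"
    by (intro sum_nonneg) auto
  have "(\<Sum>i<s. \<Sum>j<s. \<bar>A $$ (i, j)\<bar>) = 0 \<longleftrightarrow> (\<forall>i<s. \<forall>j<s. A $$ (i, j) = 0)"
    by (simp add: sum_nonneg_eq_0_iff sum_nonneg Ball_def)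
  also have "\<dots> \<longleftrightarrow> A = 0\<^sub>m s s"
    using A by auto
  finally show "(\<Sum>i<s. \<Sum>j<s. \<bar>A $$ (i, j)\<bar>) = 0 \<longleftrightarrow> A = 0\<^sub>m s s" .
  show "(\<Sum>i<s. \<Sum>j<s. \<bar>(a \<cdot>\<^sub>m A) $$ (i, j)\<bar>) = \<bar>a\<bar> * (\<Sum>i<s. \<Sum>j<s. \<bar>A $$ (i, j)\<bar>)" for a
    using A by (simp add: abs_mult sum_distrib_left)
  fix B :: "real mat" assume B: "B \<in> carrier_mat s s"
  have "(\<Sum>i<s. \<Sum>j<s. \<bar>(A + B) $$ (i, j)\<bar>)
      \<le> (\<Sum>i<s. \<Sum>j<s. \<bar>A $$ (i, j)\<bar> + \<bar>B $$ (i, j)\<bar>)"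
    using A B by (intro sum_mono) auto
  then show "(\<Sum>i<s. \<Sum>j<s. \<bar>(A + B) $$ (i, j)\<bar>)
      \<le> (\<Sum>i<s. \<Sum>j<s. \<bar>A $$ (i, j)\<bar>) + (\<Sum>i<s. \<Sum>j<s. \<bar>B $$ (i, j)\<bar>)"
    by (simp add: sum.distrib)
qed

text \<open>A nilpotent matrix has finitely many powers, so every norm is bounded on them.\<close>

lemma stable_step_nilpotent:
  assumes D: "D \<in> carrier_mat s s" and nil: "D ^\<^sub>m m = 0\<^sub>m s s"
  shows "stable_step s D"
proof -
  have zero: "D ^\<^sub>m (m + n) = 0\<^sub>m s s" for n
    using D nil by (induction n) auto
  have "range (\<lambda>n. D ^\<^sub>m n) \<subseteq> insert (0\<^sub>m s s) ((\<lambda>n. D ^\<^sub>m n) ` {..<m})"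
  proof
    fix A assume "A \<in> range (\<lambda>n. D ^\<^sub>m n)"
    then obtain n where A: "A = D ^\<^sub>m n"
      by auto
    show "A \<in> insert (0\<^sub>m s s) ((\<lambda>n. D ^\<^sub>m n) ` {..<m})"
      using A zero[of "n - m"] by (cases "n < m") auto
  qed
  then have fin: "finite (range (\<lambda>n. D ^\<^sub>m n))"
    by (rule finite_subset) simp
  have "bdd_above (range (\<lambda>n. N (D ^\<^sub>m n)))" for N :: "real mat \<Rightarrow> real"
    using finite_imageI[OF fin, of N] by (simp add: image_image)
  then show ?thesis
    unfolding stable_step_def using is_matrix_norm_sum_abs[of s] by (intro exI conjI)
qed

lemma eigenvalue_nilpotent:
  fixes A :: "'a::field mat"
  assumes A: "A \<in> carrier_mat n n" and nil: "A ^\<^sub>m m = 0\<^sub>m n n" and ev: "eigenvalue A k"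
  shows "k = 0"
proof -
  obtain v where v: "eigenvector A v k"
    using ev by (auto simp: eigenvalue_def)
  then have vn: "v \<in> carrier_vec n" "v \<noteq> 0\<^sub>v n"
    using A by (auto simp: eigenvector_def)
  have "0\<^sub>m n n *\<^sub>v v = 0\<^sub>v n"
    using vn by auto
  then have "k ^ m \<cdot>\<^sub>v v = 0\<^sub>v n"
    using eigenvector_pow[OF A v, of m] nil vn by simp
  moreover obtain i where "i < n" "v $ i \<noteq> 0"
    using vn by (metis carrier_vecD eq_vecI index_zero_vec)
  ultimately have "k ^ m = 0"
    using vn by (metis carrier_vecD index_smult_vec(1) index_zero_vec(1) mult_eq_0_iff)
  then show ?thesis
    by simp
qed

lemma strongly_stable_step_nilpotent:
  assumes D: "D \<in> carrier_mat s s" and nil: "D ^\<^sub>m m = 0\<^sub>m s s" and "s > 0"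
  shows "strongly_stable_step D"
proof -
  let ?C = "map_mat complex_of_real D"
  have C: "?C \<in> carrier_mat s s"
    using D by simp
  have "?C ^\<^sub>m m = map_mat complex_of_real (D ^\<^sub>m m)"
    by (rule of_real_hom.mat_hom_pow[OF D, symmetric])
  also have "\<dots> = 0\<^sub>m s s"
    unfolding nil by auto
  finally have nilC: "?C ^\<^sub>m m = 0\<^sub>m s s" .
  obtain k where k: "k \<in> spectrum ?C" "spectral_radius ?C = norm k"
    using spectral_radius_mem_max(1)[OF C \<open>s > 0\<close>] by auto
  then have "k = 0"
    using eigenvalue_nilpotent[OF C nilC] by (simp add: spectrum_def)
  with k show ?thesis
    by (simp add: strongly_stable_step_def)
qed

section \<open>Existence of stable and strongly stable steps\<close>

theorem corollary6:
  fixes s :: nat and c :: "real vec"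
  assumes "s \<ge> 1"
    and "c \<in> carrier_vec s"
    and "\<forall>i<s. 0 \<le> c $ i \<and> c $ i \<le> 1"
    and "\<forall>i j. i < j \<and> j < s \<longrightarrow> c $ i < c $ j"
  shows "(\<exists>D \<in> carrier_mat s s. \<exists>\<theta> \<in> carrier_vec s.
            stable_step s D \<and> step_of_order s c D \<theta>) \<and>
         (\<exists>D \<in> carrier_mat s s. \<exists>\<theta> \<in> carrier_vec s.
            strongly_stable_step D \<and> step_of_order s c D \<theta>)"
proof -
  let ?x = "\<lambda>i. c $ i - 1"
  have inj: "inj_on ?x {..<s}"
    using assms(4) by (intro linorder_inj_onI') fastforce+
  \<comment> \<open>The Lagrange polynomial of the point \<open>-1\<close> among \<open>-1, \<dots>, -s\<close>.\<close>
  define w :: "real poly" where "w = lagrange_basis s (\<lambda>k. - of_nat (Suc k)) 0"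
  have deg: "degree w < s"
    using assms(1) by (simp add: w_def degree_lagrange_basis)
  have w: "poly w (- of_nat (Suc k)) = (if k = 0 then 1 else 0)" if "k < s" for k
    unfolding w_def using that assms(1)
    by (intro poly_lagrange_basis) (auto simp: inj_on_def)
  let ?D = "transport_mat s ?x w"
  let ?\<theta> = "node_values s ?x w"
  have nil: "?D ^\<^sub>m s = 0\<^sub>m s s"
    by (rule transport_mat_nilpotent[OF inj deg w])
  have "stable_step s ?D"
    by (rule stable_step_nilpotent[OF transport_mat_carrier nil])
  moreover have "strongly_stable_step ?D"
    using assms(1) by (intro strongly_stable_step_nilpotent[OF transport_mat_carrier nil]) simp
  moreover have "step_of_order s c ?D ?\<theta>"
    by (rule step_of_order_transport_mat[OF inj])
  moreover have "?D \<in> carrier_mat s s" "?\<theta> \<in> carrier_vec s"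
    by (simp_all add: node_values_def)
  ultimately show ?thesis
    by blast
qed

end
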